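(* Let $a,b,r$ be integers with $1\leq a\leq b<r$ and $a\equiv b \pmod 2$. Let $m\geq 1$ be an integer, and let $m^*\in\{m,m+1\}$ be the unique element of $\{m,m+1\}$ that is odd. Let $G$ be an $m$-edge-connected $r$-regular graph with $n=|V(G)|$ vertices. If one of the following conditions holds, then $G$ has an $(a,b)$-parity factor: (i) $r$ is even, $a$ and $b$ are odd, $n$ is even, $\frac{r}{m}\leq b$ and $a\leq r\left(1-\frac{1}{m}\right)$; (ii) $r$ is odd, $a$ and $b$ are even, and $a\leq r\left(1-\frac{1}{m^*}\right)$; (iii) $r$, $a$ and $b$ are all odd, and $\frac{r}{m^*}\leq b$.
   Context: For integers $1\leq a\leq b$ with $a\equiv b \pmod 2$, an $(a,b)$-parity factor of a graph $G$ is a spanning subgraph $F$ of $G$ such that $a\leq d_F(v)\leq b$ and $d_F(v)\equiv b \pmod 2$ for every vertex $v\in V(G)$, where $d_F(v)$ denotes the degree of $v$ in $F$. *)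

theory Defs
  imports Complex_Main "HOL-Number_Theory.Cong"
begin

text \<open>
  A finite simple undirected graph is given by its vertex set \<open>V\<close> and its edge set \<open>E\<close>, where an
  edge is the two-element set of its endpoints. A spanning subgraph of \<open>(V, E)\<close> is then
  \<open>(V, F)\<close> with \<open>F \<subseteq> E\<close>.
\<close>

definition simple_graph :: "'a set \<Rightarrow> 'a set set \<Rightarrow> bool" where
  "simple_graph V E \<longleftrightarrow> finite V \<and> (\<forall>e\<in>E. e \<subseteq> V \<and> card e = 2)"

definition degree :: "'a set set \<Rightarrow> 'a \<Rightarrow> nat" where
  "degree E v = card {e \<in> E. v \<in> e}"

definition regular :: "nat \<Rightarrow> 'a set \<Rightarrow> 'a set set \<Rightarrow> bool" where
  "regular r V E \<longleftrightarrow> (\<forall>v\<in>V. degree E v = r)"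

definition connected_graph :: "'a set \<Rightarrow> 'a set set \<Rightarrow> bool" where
  "connected_graph V E \<longleftrightarrow> V \<noteq> {} \<and> (\<forall>u\<in>V. \<forall>v\<in>V. (u, v) \<in> {(x, y). {x, y} \<in> E}\<^sup>*)"

text \<open>
  The convention that an \<open>m\<close>-edge-connected graph has more than one vertex only excludes the graph
  with one vertex, which would otherwise be \<open>m\<close>-edge-connected for every \<open>m\<close>, and, for \<open>m = 0\<close>,
  the empty graph.
\<close>

definition edge_connected :: "nat \<Rightarrow> 'a set \<Rightarrow> 'a set set \<Rightarrow> bool" where
  "edge_connected m V E \<longleftrightarrow>
     card V > 1 \<and> (\<forall>X. X \<subseteq> E \<and> card X < m \<longrightarrow> connected_graph V (E - X))"

definition parity_factor :: "nat \<Rightarrow> nat \<Rightarrow> 'a set \<Rightarrow> 'a set set \<Rightarrow> 'a set set \<Rightarrow> bool" where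
  "parity_factor a b V E F \<longleftrightarrow>
     F \<subseteq> E \<and> (\<forall>v\<in>V. a \<le> degree F v \<and> degree F v \<le> b \<and> [degree F v = b] (mod 2))"

end

theory Submission
  imports Defs
begin

text \<open>
  Replace every vertex \<open>v\<close> by a gadget whose perfect matchings encode the choice of a degree in
  \<open>{a, a + 2, \<dots>, b}\<close>; a perfect matching of the resulting graph is then a parity factor. Giving
  every edge of the original graph the weight \<open>c / r\<close> with \<open>c = (a + b) / 2\<close> yields a fractional
  perfect matching of the gadget graph. In Tutte's theorem the condition on odd components may be
  checked by weight: it suffices that every odd vertex set has a cut of weight at least \<open>1\<close>. An odd
  set that cuts through the core of a gadget, or through an edge away from the cut it induces on
  the original graph, has this weight automatically, and for the remaining sets the bound is what
  edge connectivity (together with parity) provides. It is enough to use \<open>a = b\<close>, or for even \<open>r\<close>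
  possibly \<open>b = a + 2\<close> with \<open>c = r / 2\<close>.
\<close>

section \<open>Perfect matchings from fractional ones\<close>

definition perfect_matching :: "'n rel \<Rightarrow> 'n set \<Rightarrow> ('n \<Rightarrow> 'n) \<Rightarrow> bool" where
  "perfect_matching S V f \<longleftrightarrow> (\<forall>x\<in>V. f x \<in> V \<and> f (f x) = x \<and> (x, f x) \<in> S)"

lemma perfect_matchingD:
  assumes "perfect_matching S V f" "x \<in> V"
  shows "f x \<in> V" "f (f x) = x" "(x, f x) \<in> S"
  using assms by (auto simp: perfect_matching_def)

text \<open>Lovasz's exchange argument. If both extra edges are used, follow the walk from
  \<open>y\<close> that alternates between \<open>f\<close> and \<open>g\<close>, starting along
  \<open>f\<close>. If no \<open>u i\<close> is \<open>x\<close> or \<open>z\<close>, the walk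
  closes up and switching on it avoids both extra edges. Otherwise it reaches one of
  \<open>x\<close>, \<open>z\<close>, and the edge from \<open>y\<close> to the other one closes a
  cycle on which \<open>f\<close> can be switched.\<close>

lemma perfect_matching_exchange:
  assumes fin: "finite V" and irr: "irrefl S" and sym: "sym S"
    and f: "perfect_matching (insert (x, z) (insert (z, x) S)) V f"
    and g: "perfect_matching (insert (y, w) (insert (w, y) S)) V g"
    and xy: "(x, y) \<in> S" and yz: "(y, z) \<in> S"
    and V: "x \<in> V" "y \<in> V" "z \<in> V" "w \<in> V" and ne: "x \<noteq> z" "y \<noteq> w"
  shows "\<exists>h. perfect_matching S V h"
proof (cases "f x = z \<and> g y = w")
  case False
  then consider "f x \<noteq> z" | "g y \<noteq> w" by blast
  then show ?thesis
  proof cases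
    case 1
    have "(v, f v) \<in> S" if "v \<in> V" for v
      using perfect_matchingD[OF f that] perfect_matchingD(2)[OF f \<open>z \<in> V\<close>] 1 by auto
    then have "perfect_matching S V f" using f by (auto simp: perfect_matching_def)
    then show ?thesis by blast
  next
    case 2
    have "(v, g v) \<in> S" if "v \<in> V" for v
      using perfect_matchingD[OF g that] perfect_matchingD(2)[OF g \<open>w \<in> V\<close>] 2 by auto
    then have "perfect_matching S V g" using g by (auto simp: perfect_matching_def)
    then show ?thesis by blast
  qed
next
  case True
  then have fxz: "f x = z" "f z = x" and gyw: "g y = w" "g w = y"
    using perfect_matchingD(2)[OF f \<open>x \<in> V\<close>] perfect_matchingD(2)[OF g \<open>y \<in> V\<close>] by auto
  have fS: "(v, f v) \<in> S" if "v \<in> V" "v \<noteq> x" "v \<noteq> z" for v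
    using perfect_matchingD(3)[OF f that(1)] that by auto
  have gS: "(v, g v) \<in> S" if "v \<in> V" "v \<noteq> y" "v \<noteq> w" for v
    using perfect_matchingD(3)[OF g that(1)] that by auto
  have fV: "f v \<in> V" "f (f v) = v" "f v \<noteq> v" if "v \<in> V" for v
    using perfect_matchingD[OF f that] irr ne by (auto simp: irrefl_def)
  have gV: "g v \<in> V" "g (g v) = v" "g v \<noteq> v" if "v \<in> V" for v
    using perfect_matchingD[OF g that] irr ne by (auto simp: irrefl_def)
  define u where "u i = ((g \<circ> f) ^^ i) y" for i :: nat
  have u0: "u 0 = y" and uS: "u (Suc i) = g (f (u i))" for i
    by (simp_all add: u_def)
  have uV: "u i \<in> V" for i
    by (induction i) (auto simp: u0 uS V fV gV)
  have step_inj: "u i = u j" if "u (Suc i) = u (Suc j)" for i j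
    using that uV fV gV unfolding uS by metis
  have shift: "u (n + i) = u (n + j) \<Longrightarrow> u i = u j" for n i j
  proof (induction n)
    case (Suc n)
    then show ?case using step_inj[of "n + i" "n + j"] by simp
  qed simp
  \<comment> \<open>The cycle of the two matchings through \<open>y\<close> alternates between the \<open>u i\<close> and the \<open>f (u i)\<close>.\<close>
  have alt_le: "f (u i) \<noteq> u (i + n)" for i n
  proof (induction n arbitrary: i rule: less_induct)
    case (less n)
    show ?case
    proof
      assume eq: "f (u i) = u (i + n)"
      consider "n = 0" | "n = 1" | n' where "n = Suc (Suc n')"
        by (metis One_nat_def not0_implies_Suc)
      then show False
      proof cases
        case 1 then show False using eq fV(3)[OF uV[of i]] by simp
      next
        case 2 then show False using eq uS[of i] gV(3)[OF fV(1)[OF uV[of i]]] by simp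
      next
        case 3
        \<comment> \<open>Stepping inwards at both ends turns the equation with gap \<open>n\<close>
          into one with gap \<open>n - 2\<close>, so it descends to a fixed point of
          \<open>f\<close> or of \<open>g\<close>.\<close>
        have "u (Suc i) = g (u (Suc (i + Suc n')))" using eq 3 uS[of i] by simp
        also have "\<dots> = f (u (i + Suc n'))" unfolding uS using gV fV uV by metis
        finally have "f (u (Suc i)) = u (Suc i + n')" using fV uV by simp
        then show False using less[of n' "Suc i"] 3 by simp
      qed
    qed
  qed
  have alt: "f (u i) \<noteq> u j" for i j
  proof (cases "i \<le> j")
    case True then show ?thesis using alt_le[of i "j - i"] by simp
  next
    case False
    then have "f (u j) \<noteq> u i" using alt_le[of j "i - j"] by simp
    then show ?thesis using fV(2)[OF uV[of i]] by metis
  qed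
  show ?thesis
  proof (cases "\<exists>i. u i = x \<or> u i = z")
    case False
    define K where "K = range u \<union> f ` range u"
    have "\<not> inj u"
      using finite_subset[of "range u" V] fin uV finite_imageD[of u UNIV] by auto
    then obtain i j where ij: "i < j" "u i = u j"
      by (metis injI linorder_neqE_nat)
    define N where "N = j - Suc i"
    \<comment> \<open>Injectivity of the step carries the repetition back to the start: the walk
      returns to \<open>y\<close>, so \<open>g y\<close> lies on it too.\<close>
    have "u (Suc N) = y" using shift[of i "Suc N" 0] ij by (simp add: u0 N_def Suc_diff_Suc)
    then have gy: "g y = f (u N)" using gV fV uV uS by metis
    have fK: "f v \<in> K" if "v \<in> K" for v
      using that fV uV by (auto simp: K_def)
    have gu: "g (u i) \<in> K" for i
    proof (cases i)
      case 0 then show ?thesis using gy by (simp add: u0 K_def)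
    next
      case (Suc i')
      then have "g (u i) = f (u i')" using gV fV uV uS by metis
      then show ?thesis by (simp add: K_def)
    qed
    have gK: "g v \<in> K" if "v \<in> K" for v
      using that gu uS[symmetric] by (auto simp: K_def)
    have xK: "x \<notin> K" "z \<notin> K"
      using False fxz fV(2)[OF uV] by (auto simp: K_def)
    have yK: "y \<in> K" using u0 by (auto simp: K_def)
    then have wK: "w \<in> K" using gK gyw by metis
    \<comment> \<open>\<open>K\<close> contains \<open>y\<close> and \<open>w\<close> but neither
      \<open>x\<close> nor \<open>z\<close>, so \<open>f\<close> on \<open>K\<close> and
      \<open>g\<close> off \<open>K\<close> both avoid their extra edges.\<close>
    define h where "h v = (if v \<in> K then f v else g v)" for v
    have "perfect_matching S V h"
      unfolding perfect_matching_def
    proof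
      fix v assume v: "v \<in> V"
      show "h v \<in> V \<and> h (h v) = v \<and> (v, h v) \<in> S"
      proof (cases "v \<in> K")
        case True
        then show ?thesis using v fK[OF True] fV[OF v] fS[OF v] xK by (auto simp: h_def)
      next
        case False
        have "g v \<notin> K" using gK[of "g v"] gV[OF v] False by auto
        then show ?thesis using v False gV[OF v] gS[OF v] yK wK by (auto simp: h_def)
      qed
    qed
    then show ?thesis by blast
  next
    case True
    \<comment> \<open>By symmetry \<open>x'\<close> is whichever of \<open>x\<close>, \<open>z\<close> comes first on the walk from \<open>y\<close>.\<close>
    define k where "k = (LEAST i. u i = x \<or> u i = z)"
    have kx: "u k = x \<or> u k = z"
      unfolding k_def using True by (rule LeastI_ex)
    have kmin: "u i \<noteq> x" "u i \<noteq> z" if "i < k" for i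
      using not_less_Least that unfolding k_def by blast+
    obtain x' z' where x'z': "u k = x'" "f x' = z'" "f z' = x'" "(y, z') \<in> S" "z' \<in> V" "x' \<noteq> z'"
      "{x', z'} = {x, z}"
    proof (cases "u k = x")
      case True
      then show ?thesis using that[of x z] fxz yz V ne by auto
    next
      case False
      then show ?thesis using that[of z x] kx fxz symD[OF sym xy] V ne by auto
    qed
    have kmin': "u i \<noteq> x'" "u i \<noteq> z'" if "i < k" for i
      using kmin[OF that] x'z'(7) by auto
    have "y \<noteq> x'" using x'z' xy yz irr by (auto simp: irrefl_def doubleton_eq_iff)
    then have k0: "k > 0" using x'z'(1) u0 by (cases k) auto
    \<comment> \<open>The stretch of the walk from \<open>f y\<close> to \<open>x'\<close>. It is
      closed under \<open>g\<close>, and together with \<open>y\<close> and \<open>z'\<close> it is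
      closed under \<open>f\<close>.\<close>
    define A where "A = f ` u ` {..<k} \<union> u ` {0<..k}"
    have yA: "y \<notin> A"
    proof
      assume "y \<in> A"
      then obtain i where i: "i \<in> {0<..k}" "u i = u 0"
        using alt[of _ 0] by (auto simp: A_def u0)
      \<comment> \<open>A return to \<open>y\<close> after \<open>i\<close> steps makes the walk
        periodic, so \<open>x'\<close> would already occur at \<open>k - i\<close>.\<close>
      have "u (n + i) = u n" for n
        by (induction n) (simp_all add: uS i(2))
      from this[of "k - i"] have "u (k - i) = x'" "k - i < k"
        using i x'z'(1) by auto
      then show False using kmin' by blast
    qed
    have zA: "z' \<notin> A"
    proof
      assume "z' \<in> A"
      then consider i where "i < k" "z' = f (u i)" | i where "0 < i" "i \<le> k" "z' = u i"
        by (auto simp: A_def)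
      then show False
      proof cases
        case 1
        then have "u i = x'" using fV(2)[OF uV[of i]] x'z' by metis
        then show False using kmin' 1 by blast
      next
        case 2
        then show False using kmin'[of i] x'z' by (cases "i = k") auto
      qed
    qed
    have gA: "g v \<in> A" if "v \<in> A" for v
    proof -
      from that consider i where "i < k" "v = f (u i)" | i where "0 < i" "i \<le> k" "v = u i"
        by (auto simp: A_def)
      then show ?thesis
      proof cases
        case 1
        then have "g v = u (Suc i)" using uS by simp
        then show ?thesis using 1 by (auto simp: A_def)
      next
        case 2
        then obtain j where "i = Suc j" by (cases i) auto
        then have "g v = f (u j)" "j < k" using 2 uS gV(2)[OF fV(1)[OF uV[of j]]] by auto
        then show ?thesis by (auto simp: A_def)
      qed
    qed
    have fB: "f v \<in> insert y (insert z' A)" if "v \<in> insert y (insert z' A)" for v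
    proof -
      from that consider "v = y" | "v = z'" | i where "i < k" "v = f (u i)"
        | i where "0 < i" "i \<le> k" "v = u i"
        by (auto simp: A_def)
      then show ?thesis
      proof cases
        case 1 then show ?thesis using u0 k0 by (force simp: A_def)
      next
        case 2
        then have "f v = u k" using x'z' by simp
        then show ?thesis using k0 by (auto simp: A_def)
      next
        case 3
        then have "f v = u i" using fV(2)[OF uV[of i]] by simp
        then show ?thesis using 3 u0 by (cases i) (auto simp: A_def)
      next
        case 4
        then show ?thesis using x'z' by (cases "i = k") (auto simp: A_def)
      qed
    qed
    have wA: "w \<notin> A" using gA[of w] gyw yA by auto
    \<comment> \<open>Using \<open>g\<close> on \<open>A\<close> drops the edge from
      \<open>x'\<close> to \<open>z'\<close> and frees \<open>y\<close> and \<open>z'\<close>, which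
      are joined by an edge of \<open>S\<close>.\<close>
    define h where "h v = (if v \<in> A then g v else if v = y then z' else if v = z' then y else f v)" for v
    have "y \<noteq> z'" using x'z'(4) irr by (auto simp: irrefl_def)
    have "perfect_matching S V h"
      unfolding perfect_matching_def
    proof
      fix v assume v: "v \<in> V"
      consider "v \<in> A" | "v = y" | "v = z'" | "v \<notin> insert y (insert z' A)" by blast
      then show "h v \<in> V \<and> h (h v) = v \<and> (v, h v) \<in> S"
      proof cases
        case 1
        then show ?thesis using v gA[OF 1] gV[OF v] gS[OF v] yA wA by (auto simp: h_def)
      next
        case 2
        then show ?thesis using yA zA x'z' \<open>y \<noteq> z'\<close> by (auto simp: h_def)
      next
        case 3
        then show ?thesis using yA zA x'z' V \<open>y \<noteq> z'\<close> symD[OF sym x'z'(4)] by (auto simp: h_def)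
      next
        case 4
        have "f v \<notin> insert y (insert z' A)" using fB[of "f v"] fV[OF v] 4 by auto
        moreover have "v \<noteq> x'" using 4 x'z'(1) k0 by (auto simp: A_def)
        then have "(v, f v) \<in> S" using fS[OF v] 4 x'z'(7) by (auto simp: doubleton_eq_iff)
        ultimately show ?thesis using 4 fV[OF v] by (auto simp: h_def)
      qed
    qed
    then show ?thesis by blast
  qed
qed

section \<open>Assembling matchings from disjoint pieces\<close>

lemma perfect_matching_Un:
  assumes "perfect_matching S A f" "perfect_matching S B g" "A \<inter> B = {}"
  shows "perfect_matching S (A \<union> B) (\<lambda>x. if x \<in> A then f x else g x)"
  using assms unfolding perfect_matching_def by (auto simp: disjoint_iff)

lemma perfect_matching_UNION:
  assumes "finite I" "\<And>i. i \<in> I \<Longrightarrow> \<exists>f. perfect_matching S (A i) f"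
    and "\<And>i j. i \<in> I \<Longrightarrow> j \<in> I \<Longrightarrow> i \<noteq> j \<Longrightarrow> A i \<inter> A j = {}"
  shows "\<exists>f. perfect_matching S (\<Union>i\<in>I. A i) f"
  using assms
proof (induction I)
  case empty
  then show ?case by (simp add: perfect_matching_def)
next
  case (insert i I)
  then obtain f g where "perfect_matching S (A i) f" "perfect_matching S (\<Union>i\<in>I. A i) g"
    by (metis insertCI)
  moreover have "A i \<inter> (\<Union>i\<in>I. A i) = {}" using insert.hyps insert.prems(2)[of i] by blast
  ultimately show ?case using perfect_matching_Un[of S "A i" f "\<Union>i\<in>I. A i" g] by auto
qed

lemma perfect_matching_clique:
  assumes "even (card A)" "finite A" "\<And>x y. x \<in> A \<Longrightarrow> y \<in> A \<Longrightarrow> x \<noteq> y \<Longrightarrow> (x, y) \<in> S"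
  shows "\<exists>f. perfect_matching S A f"
  using assms
proof (induction "card A" arbitrary: A rule: less_induct)
  case less
  show ?case
  proof (cases "A = {}")
    case True
    then have "perfect_matching S A id" by (simp add: perfect_matching_def)
    then show ?thesis by blast
  next
    case False
    then have "card A \<noteq> 0" using less.prems by simp
    then have "2 \<le> card A" using less.prems(1) by presburger
    then obtain x y where xy: "x \<in> A" "y \<in> A" "x \<noteq> y"
      by (metis card_le_Suc0_iff_eq less.prems(2) not_less_eq_eq numeral_2_eq_2)
    define B where "B = A - {x, y}"
    have "card B = card A - 2" using xy less.prems by (simp add: B_def card_Diff_subset)
    then obtain f where "perfect_matching S B f"
      using less(1)[of B] less.prems \<open>2 \<le> card A\<close> by (auto simp: B_def)
    moreover have "perfect_matching S {x, y} (\<lambda>v. if v = x then y else x)"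
      using xy less.prems by (auto simp: perfect_matching_def)
    moreover have "A = B \<union> {x, y}" "B \<inter> {x, y} = {}" using xy by (auto simp: B_def)
    ultimately show ?thesis
      using perfect_matching_Un[of S B f "{x, y}" "\<lambda>v. if v = x then y else x"] by auto
  qed
qed

text \<open>Each odd clique borrows its own vertex of \<open>U\<close> through the injection
  \<open>j\<close> and becomes even. The remainder \<open>Z\<close> of \<open>U\<close> is a clique,
  and it is even because \<open>V\<close> is.\<close>

lemma perfect_matching_cliques:
  assumes fin: "finite V" and ev: "even (card V)" and UV: "U \<subseteq> V"
    and univ: "\<And>u v. u \<in> U \<Longrightarrow> v \<in> V \<Longrightarrow> u \<noteq> v \<Longrightarrow> (u, v) \<in> S \<and> (v, u) \<in> S"
    and equ: "equiv (V - U) R" and RS: "\<And>x y. (x, y) \<in> R \<Longrightarrow> x \<noteq> y \<Longrightarrow> (x, y) \<in> S"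
    and le: "card {C \<in> (V - U) // R. odd (card C)} \<le> card U"
  shows "\<exists>f. perfect_matching S V f"
proof -
  define Q where "Q = (V - U) // R"
  have QV: "C \<subseteq> V - U" if "C \<in> Q" for C
    using that Union_quotient[OF equ] by (auto simp: Q_def)
  have UnQ: "\<Union>Q = V - U" using Union_quotient[OF equ] by (simp add: Q_def)
  have disj: "C \<inter> D = {}" if "C \<in> Q" "D \<in> Q" "C \<noteq> D" for C D
    using quotient_disj[OF equ] that by (auto simp: Q_def)
  have finQ: "finite Q" using QV fin by (meson Pow_iff finite_Diff finite_Pow_iff finite_subset subsetI)
  have finC: "finite C" if "C \<in> Q" for C using QV[OF that] fin finite_subset by blast
  have finU: "finite U" using UV fin finite_subset by blast
  obtain j where j: "j ` {C \<in> Q. odd (card C)} \<subseteq> U" "inj_on j {C \<in> Q. odd (card C)}"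
    using card_le_inj[of "{C \<in> Q. odd (card C)}" U] le finQ finU by (auto simp: Q_def)
  define G where "G C = (if odd (card C) then insert (j C) C else C)" for C
  define Z where "Z = U - j ` {C \<in> Q. odd (card C)}"
  have jU: "j C \<in> U" if "C \<in> Q" "odd (card C)" for C using j that by auto
  have GV: "G C \<subseteq> V" if "C \<in> Q" for C
    using QV[OF that] jU[OF that] UV by (auto simp: G_def)
  have Geven: "even (card (G C))" if "C \<in> Q" for C
    using finC[OF that] QV[OF that] jU[OF that] by (auto simp: G_def card_insert_if)
  have CS: "(x, y) \<in> S" if "C \<in> Q" "x \<in> C" "y \<in> C" "x \<noteq> y" for C x y
    using quotient_eq_iff[OF equ, of C C x y] that RS by (auto simp: Q_def)
  have Gdisj: "G C \<inter> G D = {}" if "C \<in> Q" "D \<in> Q" "C \<noteq> D" for C D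
    using disj[OF that] QV[OF that(1)] QV[OF that(2)] jU[OF that(1)] jU[OF that(2)] that
      inj_onD[OF j(2), of C D]
    by (auto simp: G_def)
  have G: "\<exists>f. perfect_matching S (G C) f" if C: "C \<in> Q" for C
  proof (rule perfect_matching_clique)
    show "finite (G C)" using GV[OF C] fin finite_subset by blast
    show "(x, y) \<in> S" if "x \<in> G C" "y \<in> G C" "x \<noteq> y" for x y
      using that CS[OF C] univ[of "j C"] jU[OF C] GV[OF C]
      by (auto simp: G_def split: if_splits)
  qed (use Geven[OF C] in auto)
  have GU: "\<exists>f. perfect_matching S (\<Union>C\<in>Q. G C) f"
    by (rule perfect_matching_UNION) (use finQ G Gdisj in auto)
  have V: "V = (\<Union>C\<in>Q. G C) \<union> Z"
  proof
    show "(\<Union>C\<in>Q. G C) \<union> Z \<subseteq> V" using GV UV by (auto simp: Z_def)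
    have "V - U \<subseteq> (\<Union>C\<in>Q. G C)" unfolding UnQ[symmetric] by (auto simp: G_def)
    moreover have "U \<subseteq> (\<Union>C\<in>Q. G C) \<union> Z" by (auto simp: Z_def G_def)
    ultimately show "V \<subseteq> (\<Union>C\<in>Q. G C) \<union> Z" by blast
  qed
  have Zdisj: "(\<Union>C\<in>Q. G C) \<inter> Z = {}" using QV by (auto simp: Z_def G_def split: if_splits)
  have "card (\<Union>C\<in>Q. G C) = (\<Sum>C\<in>Q. card (G C))"
    by (rule card_UN_disjoint) (use finQ finite_subset[OF GV fin] Gdisj in auto)
  then have "even (card (\<Union>C\<in>Q. G C))" using Geven by (simp add: dvd_sum)
  moreover have "card V = card (\<Union>C\<in>Q. G C) + card Z"
    using card_Un_disjoint[OF _ _ Zdisj] V fin by (metis finite_Un)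
  ultimately have "even (card Z)" using ev by simp
  then have "\<exists>f. perfect_matching S Z f"
    by (rule perfect_matching_clique) (use finU UV univ in \<open>auto simp: Z_def\<close>)
  then obtain f where "perfect_matching S Z f" by blast
  moreover from GU obtain g where "perfect_matching S (\<Union>C\<in>Q. G C) g" by blast
  ultimately show ?thesis using perfect_matching_Un[OF _ _ Zdisj] V by auto
qed

section \<open>Tutte's condition checked by weight\<close>

text \<open>The double sum runs over ordered pairs, hence \<open>2 * k\<close>. In a saturated graph
  each odd class sends weight at least \<open>k\<close> to \<open>U\<close>, while a vertex of
  \<open>U\<close> receives at most \<open>k\<close>, so there are at most as many odd classes as
  universal vertices.\<close>

theorem perfect_matching_if_fractional:
  fixes w :: "'n \<Rightarrow> 'n \<Rightarrow> nat"
  assumes fin: "finite V" and k: "0 < k"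
    and sym: "\<And>p q. w p q = w q p" and irr: "\<And>p. p \<in> V \<Longrightarrow> w p p = 0"
    and row: "\<And>p. p \<in> V \<Longrightarrow> (\<Sum>q\<in>V. w p q) \<le> k"
    and cut: "\<And>C. C \<subseteq> V \<Longrightarrow> odd (card C) \<Longrightarrow>
      2 * k \<le> (\<Sum>p\<in>V. \<Sum>q\<in>V. w p q * of_bool ((p \<in> C) \<noteq> (q \<in> C)))"
  shows "\<exists>f. perfect_matching {(p, q). w p q > 0} V f"
proof (rule ccontr)
  assume no: "\<nexists>f. perfect_matching {(p, q). w p q > 0} V f"
  \<comment> \<open>Following Lovasz, work in an edge-maximal graph \<open>S\<close> without perfect matching: off the set \<open>U\<close> of
    universal vertices, its adjacency is an equivalence relation.\<close>
  define S0 where "S0 = {(p, q). p \<in> V \<and> q \<in> V \<and> w p q > 0}"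
  define \<G> where "\<G> = {S. S \<subseteq> V \<times> V \<and> Relation.sym S \<and> irrefl S \<and> S0 \<subseteq> S \<and> (\<nexists>f. perfect_matching S V f)}"
  have "perfect_matching {(p, q). w p q > 0} V f" if "perfect_matching S0 V f" for f
    using that by (auto simp: perfect_matching_def S0_def)
  then have "S0 \<in> \<G>"
    using no sym irr by (auto simp: \<G>_def S0_def sym_def irrefl_def)
  moreover have "finite \<G>"
    by (rule finite_subset[of _ "Pow (V \<times> V)"]) (auto simp: \<G>_def fin)
  ultimately obtain S where S: "S \<in> \<G>" and max: "\<And>S'. S' \<in> \<G> \<Longrightarrow> S \<subseteq> S' \<Longrightarrow> S = S'"
    using finite_has_maximal2[of \<G> S0] by metis
  have SV: "S \<subseteq> V \<times> V" and symS: "Relation.sym S" and irrS: "irrefl S" and S0S: "S0 \<subseteq> S"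
    and noS: "\<nexists>f. perfect_matching S V f"
    using S by (auto simp: \<G>_def)
  have add: "\<exists>f. perfect_matching (insert (x, y) (insert (y, x) S)) V f"
    if "x \<in> V" "y \<in> V" "x \<noteq> y" "(x, y) \<notin> S" for x y
  proof (rule ccontr)
    let ?S = "insert (x, y) (insert (y, x) S)"
    assume "\<not> ?thesis"
    then have "?S \<in> \<G>"
      using that SV symS irrS S0S by (auto simp: \<G>_def sym_def irrefl_def)
    then show False using max[of ?S] that by auto
  qed
  define U where "U = {u \<in> V. \<forall>v\<in>V. v \<noteq> u \<longrightarrow> (u, v) \<in> S}"
  \<comment> \<open>A missing edge from \<open>x\<close> to \<open>z\<close>, together with a
    non-neighbour \<open>t\<close> of \<open>y\<close>, is the configuration of
    \<open>perfect_matching_exchange\<close>; maximality supplies the two matchings.\<close>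
  have tr: "(x, z) \<in> S" if S: "(x, y) \<in> S" "(y, z) \<in> S" and yU: "y \<notin> U" and ne: "x \<noteq> z" for x y z
  proof (rule ccontr)
    assume xz: "(x, z) \<notin> S"
    have V: "x \<in> V" "y \<in> V" "z \<in> V" using S SV by auto
    then obtain t where t: "t \<in> V" "t \<noteq> y" "(y, t) \<notin> S" using yU by (auto simp: U_def)
    obtain f where "perfect_matching (insert (x, z) (insert (z, x) S)) V f"
      using add xz V ne by blast
    moreover obtain g where "perfect_matching (insert (y, t) (insert (t, y) S)) V g"
      using add t V by blast
    ultimately show False
      using perfect_matching_exchange[OF fin irrS symS] noS S ne V t by metis
  qed
  define R where "R = {(x, y). x \<in> V - U \<and> y \<in> V - U \<and> (x = y \<or> (x, y) \<in> S)}"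
  have equ: "equiv (V - U) R"
  proof (rule equivI)
    show "R \<subseteq> (V - U) \<times> (V - U)" by (auto simp: R_def)
    show "refl_on (V - U) R" by (auto simp: R_def refl_on_def)
    show "Relation.sym R" using symS by (auto simp: R_def sym_def)
    show "trans R" using tr by (auto simp: R_def intro!: transI)
  qed
  define Q where "Q = {C \<in> (V - U) // R. odd (card C)}"
  have QV: "C \<subseteq> V - U" if "C \<in> Q" for C
    using that Union_quotient[OF equ] by (auto simp: Q_def)
  have finQ: "finite Q"
    using QV fin by (meson Pow_iff finite_Diff finite_Pow_iff finite_subset subsetI)
  have UV: "U \<subseteq> V" by (auto simp: U_def)
  \<comment> \<open>Pairs of positive weight lie in \<open>S\<close>, so those leaving the class
    \<open>C\<close> end in \<open>U\<close>. The cut of \<open>C\<close> is thus twice the weight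
    between \<open>C\<close> and \<open>U\<close>.\<close>
  have oddC: "k \<le> (\<Sum>p\<in>C. \<Sum>q\<in>U. w p q)" if C: "C \<in> Q" for C
  proof -
    have CV: "C \<subseteq> V" using QV[OF C] by auto
    have zero: "w p q = 0" if "p \<in> C" "q \<in> V - C" "q \<notin> U" for p q
    proof (rule ccontr)
      assume "w p q \<noteq> 0"
      then have "(p, q) \<in> S" using that CV S0S by (auto simp: S0_def)
      then have "(p, q) \<in> R" using that QV[OF C] by (auto simp: R_def)
      then have "q \<in> C"
        using C that(1) in_quotient_imp_closed[OF equ] by (auto simp: Q_def)
      then show False using that by simp
    qed
    have inner: "(\<Sum>q\<in>V. w p q * of_bool ((p \<in> C) \<noteq> (q \<in> C))) = (\<Sum>q\<in>U. w p q)" if "p \<in> C" for p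
      by (rule sum.mono_neutral_cong_right) (use fin UV QV[OF C] that zero in auto)
    have outer: "(\<Sum>q\<in>V. w p q * of_bool ((p \<in> C) \<noteq> (q \<in> C))) = (\<Sum>q\<in>C. w q p)"
      if "p \<in> V - C" for p
      by (rule sum.mono_neutral_cong_right) (use fin CV that sym in auto)
    have "(\<Sum>p\<in>V. \<Sum>q\<in>V. w p q * of_bool ((p \<in> C) \<noteq> (q \<in> C)))
      = (\<Sum>p\<in>C. \<Sum>q\<in>U. w p q) + (\<Sum>p\<in>V - C. \<Sum>q\<in>C. w q p)"
      using sum.subset_diff[OF CV fin, of "\<lambda>p. \<Sum>q\<in>V. w p q * of_bool ((p \<in> C) \<noteq> (q \<in> C))"]
        inner outer by simp
    also have "(\<Sum>p\<in>V - C. \<Sum>q\<in>C. w q p) = (\<Sum>q\<in>C. \<Sum>p\<in>V - C. w q p)" by (rule sum.swap)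
    also have "\<dots> = (\<Sum>q\<in>C. \<Sum>p\<in>U. w q p)"
    proof (rule sum.cong[OF refl])
      fix p assume "p \<in> C"
      then show "(\<Sum>q\<in>V - C. w p q) = (\<Sum>q\<in>U. w p q)"
        by (intro sum.mono_neutral_right) (use fin UV QV[OF C] zero in auto)
    qed
    finally show ?thesis using cut[OF CV] C by (simp add: Q_def)
  qed
  have "k * card Q = (\<Sum>C\<in>Q. k)" by simp
  also have "\<dots> \<le> (\<Sum>C\<in>Q. \<Sum>p\<in>C. \<Sum>q\<in>U. w p q)"
    by (rule sum_mono) (rule oddC)
  also have "\<dots> = (\<Sum>p\<in>\<Union>Q. \<Sum>q\<in>U. w p q)"
  proof (rule sum.Union_disjoint[symmetric, unfolded comp_def])
    show "\<forall>A\<in>Q. finite A" using QV fin finite_subset by blast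
    show "\<forall>A\<in>Q. \<forall>B\<in>Q. A \<noteq> B \<longrightarrow> A \<inter> B = {}"
      using quotient_disj[OF equ] by (auto simp: Q_def)
  qed
  also have "\<dots> \<le> (\<Sum>p\<in>V. \<Sum>q\<in>U. w p q)"
    by (rule sum_mono2) (use fin QV in auto)
  also have "\<dots> = (\<Sum>q\<in>U. \<Sum>p\<in>V. w p q)" by (rule sum.swap)
  also have "\<dots> \<le> (\<Sum>q\<in>U. k)"
    using row UV sym by (intro sum_mono) (metis (no_types, lifting) subsetD sum.cong)
  finally have "card Q \<le> card U" using k by (simp add: mult.commute)
  \<comment> \<open>Otherwise \<open>V\<close> itself would be an odd set with a cut of weight
    0.\<close>
  moreover have "even (card V)"
  proof (rule ccontr)
    assume "odd (card V)"
    from cut[OF subset_refl this] k show False by simp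
  qed
  ultimately have "\<exists>f. perfect_matching S V f"
    using symS by (intro perfect_matching_cliques[OF fin _ UV _ equ])
      (auto simp: U_def R_def Q_def dest: symD)
  with noS show False by blast
qed

section \<open>The gadget graph\<close>

text \<open>For edges with two endpoints this is the usual cut; the parity form lets its size modulo
  2 be computed as a sum over all edges.\<close>

definition edge_cut :: "'a set set \<Rightarrow> 'a set \<Rightarrow> 'a set set" where
  "edge_cut E W = {e \<in> E. odd (card (e \<inter> W))}"

text \<open>
  \<open>Port v e\<close> is the half-edge of \<open>e\<close> at \<open>v\<close>. The two ports of an edge are adjacent, and matching them
  to each other means leaving the edge out of the factor. The ports at \<open>v\<close> are adjacent to all
  \<open>Core v i\<close> with \<open>i < b\<close>, and for \<open>b = a + 2\<close> the last two core nodes are adjacent to each other.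
  The weights \<open>w\<close> below are those of the fractional perfect matching, multiplied by \<open>2 * r\<close>.
\<close>

datatype 'a node = Port 'a "'a set" | Core 'a nat

locale factor_gadget =
  fixes V :: "'a set" and E :: "'a set set" and r a b c :: nat
  assumes graph: "simple_graph V E" and reg: "regular r V E"
    and a1: "1 \<le> a" and ab: "b = a \<or> b = a + 2" and abc: "a + b = 2 * c" and cr: "c \<le> r"
begin

lemma finV: "finite V" and eV: "e \<in> E \<Longrightarrow> e \<subseteq> V" and e2: "e \<in> E \<Longrightarrow> card e = 2"
  using graph by (auto simp: simple_graph_def)

lemma finE: "finite E"
  by (rule finite_subset[of _ "Pow V"]) (auto simp: finV dest: eV)

lemma finite_edge: "e \<in> E \<Longrightarrow> finite e"
  using eV finV finite_subset by blast

lemma degree_r: "v \<in> V \<Longrightarrow> card {e \<in> E. v \<in> e} = r"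
  using reg by (auto simp: regular_def degree_def)

lemma sum_incidences: "(\<Sum>v\<in>V. \<Sum>e\<in>{e \<in> E. v \<in> e}. g v e) = (\<Sum>e\<in>E. \<Sum>v\<in>e. g v e)"
proof -
  have "(\<Sum>v\<in>V. \<Sum>e\<in>{e \<in> E. v \<in> e}. g v e) = (\<Sum>e\<in>E. \<Sum>v\<in>{v \<in> V. v \<in> e}. g v e)"
    by (rule sum.swap_restrict) (use finV finE in auto)
  moreover have "{v \<in> V. v \<in> e} = e" if "e \<in> E" for e using eV[OF that] by auto
  ultimately show ?thesis by simp
qed

definition nodes :: "'a node set" where
  "nodes = (\<lambda>(e, v). Port v e) ` (SIGMA e:E. e) \<union> (\<lambda>(v, i). Core v i) ` (V \<times> {..<b})"

text \<open>The values give every node the total weight \<open>2 * r\<close>. A core node below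
  \<open>a\<close> is adjacent only to \<open>r\<close> ports and needs 2 from each; for
  \<open>b = a + 2\<close> the last two core nodes get \<open>r\<close> from each other, which
  leaves 1 per port. A port then has \<open>a + b = 2 * c\<close> towards its core and
  \<open>2 * (r - c)\<close> towards the opposite port.\<close>

definition wt :: "nat \<Rightarrow> nat" where
  "wt i = (if i < a then 2 else 1)"

fun w :: "'a node \<Rightarrow> 'a node \<Rightarrow> nat" where
  "w (Port v e) (Port u e') = (if e = e' \<and> u \<noteq> v then 2 * (r - c) else 0)"
| "w (Port v e) (Core u i) = (if u = v then wt i else 0)"
| "w (Core u i) (Port v e) = (if u = v then wt i else 0)"
| "w (Core u i) (Core v j) = (if u = v \<and> i \<noteq> j \<and> a \<le> i \<and> a \<le> j then r else 0)"

lemma Port_nodes [simp]: "Port v e \<in> nodes \<longleftrightarrow> e \<in> E \<and> v \<in> e"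
  and Core_nodes [simp]: "Core v i \<in> nodes \<longleftrightarrow> v \<in> V \<and> i < b"
  by (auto simp: nodes_def image_iff)

lemma finite_nodes: "finite nodes"
  using finV finE finite_edge by (auto simp: nodes_def)

lemma sum_nodes: "(\<Sum>q\<in>nodes. h q) = (\<Sum>e\<in>E. \<Sum>v\<in>e. h (Port v e)) + (\<Sum>v\<in>V. \<Sum>i<b. h (Core v i))"
proof -
  have "(\<Sum>q\<in>nodes. h q) = sum h ((\<lambda>(e, v). Port v e) ` (SIGMA e:E. e)) + sum h ((\<lambda>(v, i). Core v i) ` (V \<times> {..<b}))"
    unfolding nodes_def by (rule sum.union_disjoint) (use finV finE finite_edge in auto)
  also have "sum h ((\<lambda>(e, v). Port v e) ` (SIGMA e:E. e)) = (\<Sum>e\<in>E. \<Sum>v\<in>e. h (Port v e))"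
    by (subst sum.reindex) (auto simp: inj_on_def sum.Sigma finE finite_edge intro!: sum.cong)
  also have "sum h ((\<lambda>(v, i). Core v i) ` (V \<times> {..<b})) = (\<Sum>v\<in>V. \<Sum>i<b. h (Core v i))"
    by (subst sum.reindex) (auto simp: inj_on_def sum.cartesian_product intro!: sum.cong)
  finally show ?thesis .
qed

lemma w_sym: "w p q = w q p"
  by (cases p; cases q) auto

lemma w_irrefl: "w p p = 0"
  by (cases p) auto

lemma sum_wt: "(\<Sum>i<b. wt i) = 2 * c"
proof -
  have "(\<Sum>i<b. wt i) = (\<Sum>i<a. wt i) + (\<Sum>i\<in>{a..<b}. wt i)"
    using sum.atLeastLessThan_concat[of 0 a b wt] ab by (auto simp: lessThan_atLeast0)
  also have "(\<Sum>i<a. wt i) = 2 * a" by (simp add: wt_def)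
  also have "(\<Sum>i\<in>{a..<b}. wt i) = b - a" by (simp add: wt_def)
  finally show ?thesis using ab abc by auto
qed

lemma sum_Port:
  assumes "e \<in> E" "v \<in> e"
  shows "(\<Sum>q\<in>nodes. w (Port v e) q * g q)
    = 2 * (r - c) * (\<Sum>u\<in>e - {v}. g (Port u e)) + (\<Sum>i<b. wt i * g (Core v i))"
proof -
  have "(\<Sum>u\<in>e'. w (Port v e) (Port u e') * g (Port u e'))
      = (if e' = e then 2 * (r - c) * (\<Sum>u\<in>e - {v}. g (Port u e)) else 0)" if "e' \<in> E" for e'
    using finite_edge[OF assms(1)] assms
    by (auto simp: sum_distrib_left sum.remove[of e v] intro!: sum.cong)
  then have "(\<Sum>e'\<in>E. \<Sum>u\<in>e'. w (Port v e) (Port u e') * g (Port u e'))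
      = 2 * (r - c) * (\<Sum>u\<in>e - {v}. g (Port u e))"
    using assms finE by simp
  moreover have "(\<Sum>i<b. w (Port v e) (Core u i) * g (Core u i))
      = (if u = v then (\<Sum>i<b. wt i * g (Core v i)) else 0)" for u
    by auto
  then have "(\<Sum>u\<in>V. \<Sum>i<b. w (Port v e) (Core u i) * g (Core u i)) = (\<Sum>i<b. wt i * g (Core v i))"
    using assms finV eV by auto
  ultimately show ?thesis by (simp add: sum_nodes)
qed

lemma sum_Core:
  assumes "v \<in> V" "i < b"
  shows "(\<Sum>q\<in>nodes. w (Core v i) q * g q)
    = (\<Sum>e\<in>{e \<in> E. v \<in> e}. wt i * g (Port v e)) + (\<Sum>j<b. (if i \<noteq> j \<and> a \<le> i \<and> a \<le> j then r else 0) * g (Core v j))"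
proof -
  have "(\<Sum>e\<in>E. \<Sum>u\<in>e. w (Core v i) (Port u e) * g (Port u e))
    = (\<Sum>u\<in>V. \<Sum>e\<in>{e \<in> E. u \<in> e}. w (Core v i) (Port u e) * g (Port u e))"
    by (rule sum_incidences[symmetric])
  also have "\<dots> = (\<Sum>u\<in>V. if u = v then (\<Sum>e\<in>{e \<in> E. v \<in> e}. wt i * g (Port v e)) else 0)"
    by (intro sum.cong) auto
  also have "\<dots> = (\<Sum>e\<in>{e \<in> E. v \<in> e}. wt i * g (Port v e))"
    using assms finV by simp
  finally have 1: "(\<Sum>e\<in>E. \<Sum>u\<in>e. w (Core v i) (Port u e) * g (Port u e)) = \<dots>" .
  have "(\<Sum>u\<in>V. \<Sum>j<b. w (Core v i) (Core u j) * g (Core u j))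
    = (\<Sum>u\<in>V. if u = v then (\<Sum>j<b. (if i \<noteq> j \<and> a \<le> i \<and> a \<le> j then r else 0) * g (Core v j)) else 0)"
    by (intro sum.cong) auto
  also have "\<dots> = (\<Sum>j<b. (if i \<noteq> j \<and> a \<le> i \<and> a \<le> j then r else 0) * g (Core v j))"
    using assms finV by simp
  finally show ?thesis using 1 by (simp add: sum_nodes)
qed

lemma sum_w:
  assumes "p \<in> nodes"
  shows "(\<Sum>q\<in>nodes. w p q) = 2 * r"
proof (cases p)
  case (Port v e)
  then have "e \<in> E" "v \<in> e" using assms by auto
  moreover from this have "card (e - {v}) = 1" using e2 finite_edge by simp
  ultimately show ?thesis
    using sum_Port[of e v "\<lambda>_. 1"] Port sum_wt cr by simp
next
  case (Core v i)
  then have vi: "v \<in> V" "i < b" using assms by auto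
  have "(\<Sum>j<b. if i \<noteq> j \<and> a \<le> i \<and> a \<le> j then r else 0) = (if i < a then 0 else r)"
  proof (cases "i < a")
    case False
    then have "i = a \<or> i = a + 1" "b = a + 2" using vi ab by auto
    then show ?thesis using False by auto
  qed simp
  then show ?thesis
    using sum_Core[OF vi, of "\<lambda>_. 1"] Core degree_r[OF vi(1)] by (auto simp: wt_def)
qed

section \<open>Weights of cuts in the gadget graph\<close>

definition port_cut :: "'a node set \<Rightarrow> 'a \<Rightarrow> 'a set \<Rightarrow> nat" where
  "port_cut C v e = (\<Sum>i<b. wt i * of_bool ((Port v e \<in> C) \<noteq> (Core v i \<in> C)))"

text \<open>For an edge at \<open>v\<close> the sum has a single term, so it is the 0-1 indicator
  that \<open>C\<close> separates the two ports.\<close>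

definition edge_split :: "'a node set \<Rightarrow> 'a \<Rightarrow> 'a set \<Rightarrow> nat" where
  "edge_split C v e = (\<Sum>u\<in>e - {v}. of_bool ((Port v e \<in> C) \<noteq> (Port u e \<in> C)))"

definition pair_cut :: "'a node set \<Rightarrow> 'a \<Rightarrow> nat" where
  "pair_cut C v = (\<Sum>i<b. \<Sum>j<b. (if i \<noteq> j \<and> a \<le> i \<and> a \<le> j then r else 0) *
     of_bool ((Core v i \<in> C) \<noteq> (Core v j \<in> C)))"

text \<open>Port-core pairs are collected at the port for both orders, hence the factor 2 on
  \<open>port_cut\<close>. \<open>edge_split\<close> already occurs at both ends of an edge, and
  \<open>pair_cut\<close> already runs over ordered pairs.\<close>

lemma total_cut:
  "(\<Sum>p\<in>nodes. \<Sum>q\<in>nodes. w p q * of_bool ((p \<in> C) \<noteq> (q \<in> C)))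
   = (\<Sum>v\<in>V. (\<Sum>e\<in>{e \<in> E. v \<in> e}. 2 * port_cut C v e + 2 * (r - c) * edge_split C v e) + pair_cut C v)"
proof -
  have "(\<Sum>p\<in>nodes. \<Sum>q\<in>nodes. w p q * of_bool ((p \<in> C) \<noteq> (q \<in> C)))
    = (\<Sum>e\<in>E. \<Sum>v\<in>e. 2 * (r - c) * edge_split C v e + port_cut C v e)
      + (\<Sum>v\<in>V. \<Sum>i<b. (\<Sum>e\<in>{e \<in> E. v \<in> e}. wt i * of_bool ((Core v i \<in> C) \<noteq> (Port v e \<in> C)))
          + (\<Sum>j<b. (if i \<noteq> j \<and> a \<le> i \<and> a \<le> j then r else 0) *
              of_bool ((Core v i \<in> C) \<noteq> (Core v j \<in> C))))"
    unfolding sum_nodes[of "\<lambda>p. \<Sum>q\<in>nodes. w p q * of_bool ((p \<in> C) \<noteq> (q \<in> C))"]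
    by (intro arg_cong2[where f = "(+)"] sum.cong refl)
      (auto simp only: sum_Port sum_Core edge_split_def port_cut_def lessThan_iff)
  also have "(\<Sum>e\<in>E. \<Sum>v\<in>e. 2 * (r - c) * edge_split C v e + port_cut C v e)
    = (\<Sum>v\<in>V. \<Sum>e\<in>{e \<in> E. v \<in> e}. 2 * (r - c) * edge_split C v e + port_cut C v e)"
    by (rule sum_incidences[symmetric])
  also have "(\<Sum>v\<in>V. \<Sum>i<b. (\<Sum>e\<in>{e \<in> E. v \<in> e}. wt i * of_bool ((Core v i \<in> C) \<noteq> (Port v e \<in> C)))
          + (\<Sum>j<b. (if i \<noteq> j \<and> a \<le> i \<and> a \<le> j then r else 0) *
              of_bool ((Core v i \<in> C) \<noteq> (Core v j \<in> C))))
    = (\<Sum>v\<in>V. (\<Sum>e\<in>{e \<in> E. v \<in> e}. port_cut C v e) + pair_cut C v)"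
  proof (rule sum.cong[OF refl])
    fix v
    have "(\<Sum>i<b. \<Sum>e\<in>{e \<in> E. v \<in> e}. wt i * of_bool ((Core v i \<in> C) \<noteq> (Port v e \<in> C)))
      = (\<Sum>e\<in>{e \<in> E. v \<in> e}. port_cut C v e)"
      unfolding port_cut_def by (subst sum.swap) (auto intro!: sum.cong)
    then show "(\<Sum>i<b. (\<Sum>e\<in>{e \<in> E. v \<in> e}. wt i * of_bool ((Core v i \<in> C) \<noteq> (Port v e \<in> C)))
          + (\<Sum>j<b. (if i \<noteq> j \<and> a \<le> i \<and> a \<le> j then r else 0) *
              of_bool ((Core v i \<in> C) \<noteq> (Core v j \<in> C))))
      = (\<Sum>e\<in>{e \<in> E. v \<in> e}. port_cut C v e) + pair_cut C v"
      by (simp add: sum.distrib pair_cut_def)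
  qed
  finally show ?thesis
    unfolding sum.distrib sum_distrib_left[symmetric] by (simp only: mult_2 add_ac)
qed

text \<open>Wherever a port lies, it is separated from one side of a split core. If
  \<open>i < a\<close>, it loses weight 2 to node 0 or \<open>i\<close>. If \<open>a\<close> and
  \<open>a + 1\<close> are apart, it loses 1, and the edge between these two nodes supplies the
  rest. Otherwise both lie opposite to node 0, with joint weight 2.\<close>

lemma split_core_cut:
  assumes v: "v \<in> V" and i: "i < b" and split: "(Core v i \<in> C) \<noteq> (Core v 0 \<in> C)"
  shows "4 * r \<le> (\<Sum>e\<in>{e \<in> E. v \<in> e}. 2 * port_cut C v e) + pair_cut C v"
proof -
  have sub: "(\<Sum>i\<in>I. wt i * of_bool ((Port v e \<in> C) \<noteq> (Core v i \<in> C))) \<le> port_cut C v e"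
    if "I \<subseteq> {..<b}" for I e
    unfolding port_cut_def by (rule sum_mono2) (use that in auto)
  have "0 < i" using split by (cases i) auto
  have sum_ge: "k * r \<le> (\<Sum>e\<in>{e \<in> E. v \<in> e}. 2 * port_cut C v e)"
    if "\<And>e. k \<le> 2 * port_cut C v e" for k
    using sum_bounded_below[of "{e \<in> E. v \<in> e}" k "\<lambda>e. 2 * port_cut C v e"] that degree_r[OF v]
    by (simp add: mult.commute)
  consider "i < a" | "a \<le> i" "b = a + 2" "(Core v a \<in> C) \<noteq> (Core v (a + 1) \<in> C)"
    | "a \<le> i" "b = a + 2" "(Core v a \<in> C) = (Core v (a + 1) \<in> C)"
    using i ab by linarith
  then show ?thesis
  proof cases
    case 1
    have "4 \<le> 2 * port_cut C v e" for e
      using sub[of "{0, i}" e] i a1 split 1 \<open>0 < i\<close> by (cases "Port v e \<in> C") (auto simp: wt_def simp del: sum_mult_of_bool_eq split: if_splits)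
    then show ?thesis using sum_ge[of 4] by simp
  next
    case 2
    have "2 \<le> 2 * port_cut C v e" for e
      using sub[of "{a, a + 1}" e] 2 by (cases "Port v e \<in> C") (auto simp: wt_def simp del: sum_mult_of_bool_eq split: if_splits)
    moreover have "2 * r \<le> pair_cut C v"
    proof -
      have "2 * r = (\<Sum>i\<in>{a, a + 1}. \<Sum>j\<in>{a, a + 1}. (if i \<noteq> j \<and> a \<le> i \<and> a \<le> j then r else 0) *
         of_bool ((Core v i \<in> C) \<noteq> (Core v j \<in> C)))"
        using 2 by auto
      also have "\<dots> \<le> (\<Sum>i\<in>{a, a + 1}. \<Sum>j<b. (if i \<noteq> j \<and> a \<le> i \<and> a \<le> j then r else 0) *
         of_bool ((Core v i \<in> C) \<noteq> (Core v j \<in> C)))"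
        by (intro sum_mono sum_mono2) (use 2 in auto)
      also have "\<dots> \<le> pair_cut C v"
        unfolding pair_cut_def by (rule sum_mono2) (use 2 in auto)
      finally show ?thesis .
    qed
    ultimately show ?thesis using sum_ge[of 2] by simp
  next
    case 3
    have "i = a \<or> i = a + 1" using 3 i by auto
    then have "(Core v a \<in> C) \<noteq> (Core v 0 \<in> C)" "(Core v (a + 1) \<in> C) \<noteq> (Core v 0 \<in> C)"
      using 3 split by auto
    then have "4 \<le> 2 * port_cut C v e" for e
      using sub[of "{0, a, a + 1}" e] a1 3 by (cases "Port v e \<in> C") (auto simp: wt_def simp del: sum_mult_of_bool_eq split: if_splits)
    then show ?thesis using sum_ge[of 4] by simp
  qed
qed

text \<open>If no core is split, the cost of \<open>C\<close> is governed by the set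
  \<open>W\<close> of vertices whose core lies in \<open>C\<close> and the set \<open>D\<close> of
  edges whose ports are separated. When \<open>D\<close> lies inside the cut of \<open>W\<close>,
  the hypotheses \<open>core\<close> and \<open>port\<close> treat the extremes, \<open>D\<close>
  empty and \<open>D\<close> the whole cut.\<close>

lemma odd_cut_ge:
  assumes C: "C \<subseteq> nodes" "odd (card C)"
    and bn: "even (b * card V)"
    and core: "\<And>W. W \<subseteq> V \<Longrightarrow> W \<noteq> {} \<Longrightarrow> W \<noteq> V \<Longrightarrow> odd (b * card W) \<Longrightarrow> r \<le> c * card (edge_cut E W)"
    and port: "\<And>W. W \<subseteq> V \<Longrightarrow> W \<noteq> {} \<Longrightarrow> W \<noteq> V \<Longrightarrow> odd (b * card W + card (edge_cut E W))
      \<Longrightarrow> r \<le> (r - c) * card (edge_cut E W)"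
  shows "4 * r \<le> (\<Sum>p\<in>nodes. \<Sum>q\<in>nodes. w p q * of_bool ((p \<in> C) \<noteq> (q \<in> C)))"
proof (cases "\<exists>v\<in>V. \<exists>i<b. (Core v i \<in> C) \<noteq> (Core v 0 \<in> C)")
  case True
  then obtain v i where v: "v \<in> V" and i: "i < b" "(Core v i \<in> C) \<noteq> (Core v 0 \<in> C)" by blast
  have "4 * r \<le> (\<Sum>e\<in>{e \<in> E. v \<in> e}. 2 * port_cut C v e) + pair_cut C v"
    by (rule split_core_cut[OF v i])
  also have "\<dots> \<le> (\<Sum>e\<in>{e \<in> E. v \<in> e}. 2 * port_cut C v e + 2 * (r - c) * edge_split C v e) + pair_cut C v"
    by (intro add_right_mono sum_mono) simp
  also have "\<dots> \<le> (\<Sum>v\<in>V. (\<Sum>e\<in>{e \<in> E. v \<in> e}. 2 * port_cut C v e + 2 * (r - c) * edge_split C v e) + pair_cut C v)"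
    by (rule member_le_sum[OF v]) (use finV in auto)
  finally show ?thesis unfolding total_cut .
next
  case False
  define W where "W = {v \<in> V. Core v 0 \<in> C}"
  have unsplit: "Core v i \<in> C \<longleftrightarrow> v \<in> W" if "v \<in> V" "i < b" for v i
    using False that unfolding W_def by blast
  define D where "D = {e \<in> E. odd (card {v \<in> e. Port v e \<in> C})}"
  define \<delta> where "\<delta> = edge_cut E W"
  define cost where "cost e = (\<Sum>v\<in>e. 2 * port_cut C v e + 2 * (r - c) * edge_split C v e)" for e
  have fin: "finite D" "finite \<delta>" using finE by (auto simp: D_def \<delta>_def edge_cut_def)
  have DE: "D \<subseteq> E" "\<delta> \<subseteq> E" by (auto simp: D_def \<delta>_def edge_cut_def)
  have port_cut: "port_cut C v e = 2 * c * of_bool ((Port v e \<in> C) \<noteq> (v \<in> W))" if "v \<in> V" for v e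
  proof -
    have "port_cut C v e = (\<Sum>i<b. wt i * of_bool ((Port v e \<in> C) \<noteq> (v \<in> W)))"
      unfolding port_cut_def using unsplit[OF that] by (intro sum.cong) auto
    then show ?thesis by (simp add: sum_distrib_right[symmetric] sum_wt)
  qed
  \<comment> \<open>With cores contracted, an edge is a path core, port, port, core with link costs
    \<open>4 * c\<close>, \<open>4 * (r - c)\<close>, \<open>4 * c\<close>. \<open>\<delta>\<close>
    records that the ends differ, \<open>D\<close> that the middle link is cut; if the middle is cut
    and the ends agree, exactly one outer link is cut too.\<close>
  have cost: "(e \<in> D \<longrightarrow> 4 * (r - c) \<le> cost e) \<and> (e \<in> D \<longrightarrow> e \<notin> \<delta> \<longrightarrow> 4 * r \<le> cost e)
      \<and> (e \<notin> D \<longrightarrow> e \<in> \<delta> \<longrightarrow> 4 * c \<le> cost e)" if e: "e \<in> E" for e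
  proof -
    obtain u v where uv: "e = {u, v}" "u \<noteq> v" using e2[OF e] by (auto simp: card_2_iff)
    have "u \<in> V" "v \<in> V" using eV[OF e] uv by auto
    have "{u, v} - {u} = {v}" "{u, v} - {v} = {u}" using uv by auto
    then have cost_e: "cost e = 4 * c * of_bool ((Port u e \<in> C) \<noteq> (u \<in> W)) + 4 * c * of_bool ((Port v e \<in> C) \<noteq> (v \<in> W))
        + 4 * (r - c) * of_bool ((Port u e \<in> C) \<noteq> (Port v e \<in> C))"
      using uv(2) \<open>u \<in> V\<close> \<open>v \<in> V\<close>
      by (auto simp: uv(1) cost_def edge_split_def port_cut)
    have "{x \<in> e. Port x e \<in> C} = (if Port u e \<in> C then {u} else {}) \<union> (if Port v e \<in> C then {v} else {})"
      using uv by auto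
    then have D: "e \<in> D \<longleftrightarrow> (Port u e \<in> C) \<noteq> (Port v e \<in> C)"
      using e uv(2) by (auto simp: D_def)
    have "e \<inter> W = (if u \<in> W then {u} else {}) \<union> (if v \<in> W then {v} else {})"
      using uv by auto
    then have d: "e \<in> \<delta> \<longleftrightarrow> (u \<in> W) \<noteq> (v \<in> W)"
      using e uv(2) by (auto simp: \<delta>_def edge_cut_def)
    show ?thesis unfolding cost_e D d using cr
      by (cases "Port u e \<in> C"; cases "Port v e \<in> C"; cases "u \<in> W"; cases "v \<in> W") auto
  qed
  \<comment> \<open>Each core contributes \<open>b\<close> nodes or none, and the ports contribute
    an odd number exactly on the edges of \<open>D\<close>.\<close>
  have parity: "odd (b * card W + card D)"
  proof -
    have "card C = (\<Sum>q\<in>nodes. of_bool (q \<in> C))"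
      using C finite_nodes by (simp add: Int_absorb1)
    also have "\<dots> = (\<Sum>e\<in>E. card {v \<in> e. Port v e \<in> C}) + (\<Sum>v\<in>V. b * of_bool (v \<in> W))"
    proof -
      have "(\<Sum>v\<in>e. of_bool (Port v e \<in> C)) = card {v \<in> e. Port v e \<in> C}" if "e \<in> E" for e
        using finite_edge[OF that] by (simp add: Int_def)
      moreover have "(\<Sum>i<b. of_bool (Core v i \<in> C)) = b * of_bool (v \<in> W)" if "v \<in> V" for v
      proof -
        have "(\<Sum>i<b. of_bool (Core v i \<in> C)) = (\<Sum>i<b. of_bool (v \<in> W) :: nat)"
          using unsplit[OF that] by (intro sum.cong) auto
        then show ?thesis by simp
      qed
      ultimately show ?thesis unfolding sum_nodes by (intro arg_cong2[where f = "(+)"] sum.cong) auto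
    qed
    also have "(\<Sum>v\<in>V. b * of_bool (v \<in> W)) = b * card W"
      using finV by (simp add: sum_distrib_left[symmetric] Int_def W_def conj_commute)
    finally have "card C = (\<Sum>e\<in>E. card {v \<in> e. Port v e \<in> C}) + b * card W" .
    moreover have "even (\<Sum>e\<in>E. card {v \<in> e. Port v e \<in> C}) \<longleftrightarrow> even (card D)"
      unfolding D_def by (rule even_sum_iff[OF finE])
    ultimately show ?thesis using C(2) by simp
  qed
  have sum_sub: "(\<Sum>e\<in>I. cost e) \<le> (\<Sum>e\<in>E. cost e)" if "I \<subseteq> E" for I
    by (rule sum_mono2) (use that finE in auto)
  have "4 * r \<le> (\<Sum>e\<in>E. cost e)"
  proof (cases "D \<subseteq> \<delta>")
    case False
    then obtain e where "e \<in> D" "e \<notin> \<delta>" by blast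
    then show ?thesis using cost[of e] sum_sub[of "{e}"] DE by auto
  next
    case True
    have "(\<Sum>e\<in>D. 4 * (r - c)) \<le> (\<Sum>e\<in>D. cost e)" "(\<Sum>e\<in>\<delta> - D. 4 * c) \<le> (\<Sum>e\<in>\<delta> - D. cost e)"
      using cost DE by (blast intro: sum_mono)+
    moreover have "(\<Sum>e\<in>\<delta>. cost e) = (\<Sum>e\<in>\<delta> - D. cost e) + (\<Sum>e\<in>D. cost e)"
      by (rule sum.subset_diff[OF True fin(2)])
    ultimately have ge: "4 * (r - c) * card D + 4 * c * card (\<delta> - D) \<le> (\<Sum>e\<in>E. cost e)"
      using sum_sub[OF DE(2)] by (simp add: mult.commute)
    have "W \<subseteq> V" by (auto simp: W_def)
    have "\<delta> = {}" if "W = {} \<or> W = V"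
    proof -
      have "e \<inter> W = {} \<or> e \<inter> W = e" if "e \<in> E" for e
        using eV[OF that] \<open>W = {} \<or> W = V\<close> by auto
      then show ?thesis using e2 by (fastforce simp: \<delta>_def edge_cut_def)
    qed
    \<comment> \<open>For \<open>W = {}\<close> or \<open>W = V\<close> the cut, and with it
      \<open>D\<close>, is empty, so \<open>parity\<close> would make \<open>b * card W\<close> odd;
      for \<open>W = V\<close> this contradicts \<open>bn\<close>.\<close>
    then have W: "W \<noteq> {}" "W \<noteq> V" using parity bn True by auto
    consider "D = {}" | "D = \<delta>" | "D \<noteq> {}" "\<delta> - D \<noteq> {}" using True by blast
    then show ?thesis
    proof cases
      case 1
      then have "r \<le> c * card \<delta>" using core[OF \<open>W \<subseteq> V\<close> W] parity by (simp add: \<delta>_def)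
      then show ?thesis using ge 1 by simp
    next
      case 2
      then have "r \<le> (r - c) * card \<delta>" using port[OF \<open>W \<subseteq> V\<close> W] parity by (simp add: \<delta>_def)
      then show ?thesis using ge 2 by simp
    next
      case 3
      then have "1 \<le> card D" "1 \<le> card (\<delta> - D)" using fin by (auto simp: Suc_le_eq card_gt_0_iff)
      \<comment> \<open>One edge of each kind is enough: the two costs add up to
        \<open>4 * r\<close>.\<close>
      then have "4 * (r - c) * 1 + 4 * c * 1 \<le> 4 * (r - c) * card D + 4 * c * card (\<delta> - D)"
        by (intro add_mono mult_le_mono2)
      then show ?thesis using ge cr by (simp del: mult_le_cancel1)
    qed
  qed
  also have "(\<Sum>e\<in>E. cost e) = (\<Sum>v\<in>V. \<Sum>e\<in>{e \<in> E. v \<in> e}. 2 * port_cut C v e + 2 * (r - c) * edge_split C v e)"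
    unfolding cost_def by (rule sum_incidences[symmetric])
  also have "\<dots> \<le> (\<Sum>v\<in>V. (\<Sum>e\<in>{e \<in> E. v \<in> e}. 2 * port_cut C v e + 2 * (r - c) * edge_split C v e) + pair_cut C v)"
    by (intro sum_mono) simp
  finally show ?thesis unfolding total_cut .
qed

section \<open>From perfect matchings back to factors\<close>

text \<open>The degree at \<open>v\<close> is the number of its core nodes matched to ports. Those
  below \<open>a\<close> have no other neighbours, and for \<open>b = a + 2\<close> the last two are
  matched to each other or both to ports, so only the degrees \<open>a\<close> and \<open>b\<close>
  occur.\<close>

lemma parity_factor_of_matching:
  assumes f: "perfect_matching {(p, q). w p q > 0} nodes f"
  shows "\<exists>F. parity_factor a b V E F"
proof -
  note fD = perfect_matchingD[OF f]
  define F where "F = {e \<in> E. \<forall>v\<in>e. \<exists>i. f (Port v e) = Core v i}"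
  have port: "(\<exists>i<b. f (Port v e) = Core v i) \<or> (\<exists>u\<in>e - {v}. f (Port v e) = Port u e)"
    if "e \<in> E" "v \<in> e" for v e
    using fD[of "Port v e"] that by (cases "f (Port v e)") (auto split: if_splits)
  have core: "(\<exists>e\<in>E. v \<in> e \<and> f (Core v i) = Port v e) \<or>
      (\<exists>j<b. j \<noteq> i \<and> a \<le> i \<and> a \<le> j \<and> f (Core v i) = Core v j)" if "v \<in> V" "i < b" for v i
    using fD[of "Core v i"] that by (cases "f (Core v i)") (auto split: if_splits)
  \<comment> \<open>Ports matched to each other come in pairs, so membership in \<open>F\<close> can
    be tested at a single endpoint.\<close>
  have F: "e \<in> F \<longleftrightarrow> (\<exists>i<b. f (Port v e) = Core v i)" if e: "e \<in> E" "v \<in> e" for v e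
  proof
    assume "e \<in> F"
    then show "\<exists>i<b. f (Port v e) = Core v i" using port[OF e] e by (auto simp: F_def)
  next
    assume R: "\<exists>i<b. f (Port v e) = Core v i"
    have "\<exists>i. f (Port u e) = Core u i" if u: "u \<in> e" for u
    proof (rule ccontr)
      assume no: "\<nexists>i. f (Port u e) = Core u i"
      then obtain x where x: "x \<in> e - {u}" "f (Port u e) = Port x e" using port[OF e(1) u] by auto
      have "u \<noteq> v" using no R by auto
      then have "e = {u, v}" using e2[OF e(1)] e u by (auto simp: card_2_iff)
      then have "f (Port v e) = Port u e" using fD(2)[of "Port u e"] x e u by auto
      then show False using R by auto
    qed
    then show "e \<in> F" using e by (auto simp: F_def)
  qed
  have deg: "degree F v = a \<or> degree F v = b" if v: "v \<in> V" for v
  proof -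
    define I where "I = {i. i < b \<and> (\<exists>e\<in>E. v \<in> e \<and> f (Core v i) = Port v e)}"
    have "degree F v = card ((\<lambda>e. f (Port v e)) ` {e \<in> F. v \<in> e})"
      unfolding degree_def
    proof (rule card_image[symmetric], rule inj_onI)
      fix d e assume de: "d \<in> {e \<in> F. v \<in> e}" "e \<in> {e \<in> F. v \<in> e}" "f (Port v d) = f (Port v e)"
      then have "Port v d \<in> nodes" "Port v e \<in> nodes" by (auto simp: F_def)
      then have "Port v d = Port v e" using de(3) fD(2) by metis
      then show "d = e" by simp
    qed
    also have "(\<lambda>e. f (Port v e)) ` {e \<in> F. v \<in> e} = Core v ` I"
    proof (intro equalityI subsetI)
      fix q assume "q \<in> (\<lambda>e. f (Port v e)) ` {e \<in> F. v \<in> e}"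
      then obtain e where e: "e \<in> F" "v \<in> e" "q = f (Port v e)" by blast
      then have "e \<in> E" by (auto simp: F_def)
      then obtain i where "i < b" "q = Core v i" using F[of e v] e by auto
      moreover have "f q = Port v e" using fD(2)[of "Port v e"] e \<open>e \<in> E\<close> by auto
      ultimately show "q \<in> Core v ` I" using \<open>e \<in> E\<close> e by (auto simp: I_def)
    next
      fix q assume "q \<in> Core v ` I"
      then obtain i e where i: "i < b" "e \<in> E" "v \<in> e" "f (Core v i) = Port v e" "q = Core v i"
        by (auto simp: I_def)
      then have "f (Port v e) = Core v i" using fD(2)[of "Core v i"] v by simp
      then show "q \<in> (\<lambda>e. f (Port v e)) ` {e \<in> F. v \<in> e}"
        using F[of e v] i by force
    qed
    also have "card (Core v ` I) = card I" by (rule card_image) (simp add: inj_on_def)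
    finally have degI: "degree F v = card I" .
    have lowI: "{..<a} \<subseteq> I"
    proof
      fix i assume "i \<in> {..<a}"
      then show "i \<in> I" using core[OF v, of i] ab by (auto simp: I_def)
    qed
    have Ib: "I \<subseteq> {..<b}" by (auto simp: I_def)
    show ?thesis
    proof (cases "b = a")
      case True
      then have "I = {..<b}" using lowI Ib by auto
      then show ?thesis using degI by simp
    next
      case False
      then have b2: "b = a + 2" using ab by simp
      \<comment> \<open>A core node outside \<open>I\<close> is matched to a core node, which must
        be the other one of the last two.\<close>
      have notI: "j \<notin> I" if ij: "i \<notin> I" "i < b" "j < b" "i \<noteq> j" "a \<le> j" for i j
      proof -
        obtain j' where j': "j' < b" "j' \<noteq> i" "a \<le> i" "a \<le> j'" "f (Core v i) = Core v j'"
          using core[OF v \<open>i < b\<close>] ij by (auto simp: I_def)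
        then have "j' = j" using that b2 by auto
        then have "f (Core v j) = Core v i" using fD(2)[of "Core v i"] j' v that by auto
        then show ?thesis by (auto simp: I_def)
      qed
      have b_eq: "{..<b} = {..<a} \<union> {a, a + 1}" using b2 by auto
      have "I = {..<a} \<or> I = {..<b}"
      proof (cases "a \<in> I")
        case True
        then have "a + 1 \<in> I" using notI[of "a + 1" a] b2 by auto
        then have "{..<b} \<subseteq> I" using lowI True b_eq by auto
        then show ?thesis using Ib by blast
      next
        case False
        then have "a + 1 \<notin> I" using notI[of a "a + 1"] b2 by auto
        then have "I \<subseteq> {..<a}" using Ib False b_eq by blast
        then show ?thesis using lowI by blast
      qed
      then show ?thesis using degI by auto
    qed
  qed
  have "parity_factor a b V E F"
    unfolding parity_factor_def
  proof (intro conjI ballI)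
    show "F \<subseteq> E" by (auto simp: F_def)
    fix v assume "v \<in> V"
    from deg[OF this] ab show "a \<le> degree F v" "degree F v \<le> b" "[degree F v = b] (mod 2)"
      by (auto simp: cong_def)
  qed
  then show ?thesis by blast
qed

text \<open>\<open>W\<close> can be separated at the port-core links of its cut edges, at cost
  \<open>c\<close> each, or at their port-port links, at cost \<open>r - c\<close> each. The parity
  conditions say when the resulting node set is odd.\<close>

theorem parity_factor_if_cuts:
  assumes "0 < r" and "even (b * card V)"
    and "\<And>W. W \<subseteq> V \<Longrightarrow> W \<noteq> {} \<Longrightarrow> W \<noteq> V \<Longrightarrow> odd (b * card W) \<Longrightarrow> r \<le> c * card (edge_cut E W)"
    and "\<And>W. W \<subseteq> V \<Longrightarrow> W \<noteq> {} \<Longrightarrow> W \<noteq> V \<Longrightarrow> odd (b * card W + card (edge_cut E W))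
      \<Longrightarrow> r \<le> (r - c) * card (edge_cut E W)"
  shows "\<exists>F. parity_factor a b V E F"
proof -
  have "\<exists>f. perfect_matching {(p, q). w p q > 0} nodes f"
  proof (rule perfect_matching_if_fractional)
    show "2 * (2 * r) \<le> (\<Sum>p\<in>nodes. \<Sum>q\<in>nodes. w p q * of_bool ((p \<in> C) \<noteq> (q \<in> C)))"
      if "C \<subseteq> nodes" "odd (card C)" for C
      using odd_cut_ge[OF that assms(2-)] by simp
  qed (use finite_nodes w_sym w_irrefl sum_w assms(1) in auto)
  then show ?thesis using parity_factor_of_matching by blast
qed

end

section \<open>Edge connectivity\<close>

text \<open>Once the cut is removed, every walk that starts in \<open>W\<close> stays in
  \<open>W\<close>.\<close>

lemma edge_connected_cut:
  assumes graph: "simple_graph V E" and conn: "edge_connected m V E"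
    and W: "W \<subseteq> V" "W \<noteq> {}" "W \<noteq> V"
  shows "m \<le> card (edge_cut E W)"
proof (rule ccontr)
  assume "\<not> ?thesis"
  then have "connected_graph V (E - edge_cut E W)"
    using conn by (auto simp: edge_connected_def edge_cut_def)
  moreover obtain x y where xy: "x \<in> W" "y \<in> V" "y \<notin> W" using W by blast
  ultimately have "(x, y) \<in> {(x, y). {x, y} \<in> E - edge_cut E W}\<^sup>*"
    using W by (auto simp: connected_graph_def)
  then have "y \<in> W"
  proof (induction rule: rtrancl_induct)
    case base
    then show ?case using xy by simp
  next
    case (step u v)
    then have uv: "{u, v} \<in> E" "even (card ({u, v} \<inter> W))" by (auto simp: edge_cut_def)
    then have "u \<noteq> v" using graph by (auto simp: simple_graph_def)
    show ?case
    proof (rule ccontr)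
      assume "v \<notin> W"
      then have "{u, v} \<inter> W = {u}" using step by auto
      then show False using uv by simp
    qed
  qed
  then show False using xy by simp
qed

text \<open>The degree sum over \<open>W\<close> counts each edge as often as it has endpoints in
  \<open>W\<close>, so modulo 2 only the cut edges remain.\<close>

lemma even_edge_cut_iff:
  assumes "simple_graph V E" "regular r V E" "W \<subseteq> V"
  shows "even (card (edge_cut E W)) \<longleftrightarrow> even (r * card W)"
proof -
  have finV: "finite V" and EV: "\<And>e. e \<in> E \<Longrightarrow> e \<subseteq> V"
    using assms by (auto simp: simple_graph_def)
  have finE: "finite E"
    by (rule finite_subset[of _ "Pow V"]) (use EV finV in auto)
  have finW: "finite W" using finV assms(3) finite_subset by blast
  have "r * card W = (\<Sum>v\<in>W. \<Sum>e\<in>{e \<in> E. v \<in> e}. 1)"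
    using assms by (auto simp: regular_def degree_def subset_iff mult.commute)
  also have "\<dots> = (\<Sum>e\<in>E. \<Sum>v\<in>{v \<in> W. v \<in> e}. 1)"
    by (rule sum.swap_restrict) (use finW finE in auto)
  also have "\<dots> = (\<Sum>e\<in>E. card (e \<inter> W))"
    by (auto simp: Int_def conj_commute)
  finally show ?thesis
    unfolding edge_cut_def using even_sum_iff[OF finE, of "\<lambda>e. card (e \<inter> W)"] by simp
qed

section \<open>Choosing the degrees in the three cases\<close>

lemma parity_factor_mono:
  assumes "parity_factor a' b' V E F" "a \<le> a'" "b' \<le> b" "[b' = b] (mod 2)"
  shows "parity_factor a b V E F"
  using assms unfolding parity_factor_def by (meson cong_trans le_trans)

theorem theorem2p1:
  fixes a b r m m' n :: nat and V :: "'a set" and E :: "'a set set"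
  assumes "1 \<le> a" and "a \<le> b" and "b < r" and "[a = b] (mod 2)"
    and "1 \<le> m"
    and "m' \<in> {m, m + 1}" and "odd m'"
    and "simple_graph V E" and "edge_connected m V E" and "regular r V E"
    and "n = card V"
    and "(even r \<and> odd a \<and> odd b \<and> even n \<and>
            real r / real m \<le> real b \<and> real a \<le> real r * (1 - 1 / real m)) \<or>
         (odd r \<and> even a \<and> even b \<and> real a \<le> real r * (1 - 1 / real m')) \<or>
         (odd r \<and> odd a \<and> odd b \<and> real r / real m' \<le> real b)"
  shows "\<exists>F. parity_factor a b V E F"
proof -
  note graph = assms(8) and reg = assms(10)
  have cut_m: "m \<le> card (edge_cut E W)" if "W \<subseteq> V" "W \<noteq> {}" "W \<noteq> V" for W
    using edge_connected_cut[OF graph assms(9) that] .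
  \<comment> \<open>If \<open>m\<close> is even, an odd cut cannot have exactly \<open>m\<close>
    edges.\<close>
  have cut_m': "m' \<le> card (edge_cut E W)"
    if "W \<subseteq> V" "W \<noteq> {}" "W \<noteq> V" "odd (card (edge_cut E W))" for W
  proof (cases "m' = m")
    case False
    then have "m' = m + 1" "even m" using assms(6,7) by auto
    then show ?thesis using cut_m[OF that(1-3)] that(4)
      by (metis Suc_eq_plus1 le_antisym not_less_eq_eq)
  qed (use cut_m that in auto)
  note cut_parity = even_edge_cut_iff[OF graph reg]
  have r0: "0 < r" using assms(3) by simp
  have upper: "r \<le> (r - x) * k" if "real x \<le> real r * (1 - 1 / real k)" "0 < k" "x < r" for x k
  proof -
    have "real k * real x \<le> real k * (real r * (1 - 1 / real k))"
      using that by (intro mult_left_mono) auto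
    also have "\<dots> = real k * real r - real r" using that by (simp add: field_simps)
    finally have "real r \<le> real ((r - x) * k)" using that by (simp add: algebra_simps)
    then show ?thesis by (simp only: of_nat_le_iff)
  qed
  have lower: "r \<le> x * k" if "real r / real k \<le> real x" "0 < k" for x k
  proof -
    have "real r \<le> real (x * k)" using that by (simp add: field_simps)
    then show ?thesis by (simp only: of_nat_le_iff)
  qed
  have m'0: "0 < m'" using assms(7) by (cases m') auto
  from assms(12) show ?thesis
  proof (elim disjE conjE)
    assume h: "odd r" "even a" "even b" "real a \<le> real r * (1 - 1 / real m')"
    \<comment> \<open>All degrees are to be \<open>a\<close>. As \<open>a\<close> is even, the first
      cut condition is vacuous and the second concerns odd cuts only.\<close>
    interpret factor_gadget V E r a a a
      by unfold_locales (use assms in auto)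
    have "r \<le> (r - a) * card (edge_cut E W)"
      if "W \<subseteq> V" "W \<noteq> {}" "W \<noteq> V" "odd (a * card W + card (edge_cut E W))" for W
    proof -
      have "m' \<le> card (edge_cut E W)" using cut_m'[OF that(1-3)] that(4) h by simp
      then have "(r - a) * m' \<le> (r - a) * card (edge_cut E W)" by (rule mult_le_mono2)
      then show ?thesis using upper[OF h(4) m'0] assms(2,3) by linarith
    qed
    then obtain F where "parity_factor a a V E F"
      using parity_factor_if_cuts[OF r0] h by auto
    then show ?thesis using parity_factor_mono assms by blast
  next
    assume h: "odd r" "odd a" "odd b" "real r / real m' \<le> real b"
    \<comment> \<open>All degrees are to be \<open>b\<close>. As \<open>r\<close> and
      \<open>b\<close> are odd, \<open>b * card W\<close> and the size of the cut have the same
      parity, so the second cut condition is vacuous.\<close>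
    interpret factor_gadget V E r b b b
      by unfold_locales (use assms in auto)
    have "r \<le> b * card (edge_cut E W)"
      if "W \<subseteq> V" "W \<noteq> {}" "W \<noteq> V" "odd (b * card W)" for W
    proof -
      have "m' \<le> card (edge_cut E W)"
        using cut_m'[OF that(1-3)] cut_parity[OF that(1)] that(4) h by simp
      then have "b * m' \<le> b * card (edge_cut E W)" by (rule mult_le_mono2)
      then show ?thesis using lower[OF h(4) m'0] by linarith
    qed
    moreover have "\<not> odd (b * card W + card (edge_cut E W))" if "W \<subseteq> V" for W
      using cut_parity[OF that] h by simp
    \<comment> \<open>The empty cut of \<open>V\<close> yields the handshake parity:
      \<open>r * card V\<close> is even, so \<open>card V\<close> is.\<close>
    moreover have "edge_cut E V = {}"
    proof -
      have "e \<inter> V = e" "card e = 2" if "e \<in> E" for e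
        using graph that by (auto simp: simple_graph_def)
      then show ?thesis by (auto simp: edge_cut_def)
    qed
    then have "even (card V)" using cut_parity[of V] h by simp
    ultimately obtain F where "parity_factor b b V E F"
      using parity_factor_if_cuts[OF r0] by auto
    then show ?thesis using parity_factor_mono[of b b V E F a b] assms(2) by auto
  next
    assume h: "even r" "odd a" "odd b" "even n" "real r / real m \<le> real b"
      "real a \<le> real r * (1 - 1 / real m)"
    have m0: "0 < m" using assms(5) by simp
    have ra: "r \<le> (r - a) * m" using upper[OF h(6) m0] assms(2,3) by simp
    have rb: "r \<le> b * m" using lower[OF h(5) m0] .
    \<comment> \<open>For \<open>m = 1\<close> the bound \<open>ra\<close> would read
      \<open>r \<le> r - a\<close>.\<close>
    have "m \<noteq> 1" using ra assms(1,3) r0 assms(2) by auto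
    then have m2: "2 \<le> m" using assms(5) by simp
    \<comment> \<open>Every cut has at least \<open>m\<close> edges, so the two bounds on the mean
      degree \<open>z\<close> give both cut conditions regardless of parity.\<close>
    have near: "\<exists>F. parity_factor x y V E F"
      if "1 \<le> x" "y = x \<or> y = x + 2" "x + y = 2 * z" "z \<le> r" "r \<le> z * m" "r \<le> (r - z) * m" for x y z
    proof -
      interpret factor_gadget V E r x y z
        by unfold_locales (use graph reg that in auto)
      have "r \<le> z * card (edge_cut E W)" "r \<le> (r - z) * card (edge_cut E W)"
        if "W \<subseteq> V" "W \<noteq> {}" "W \<noteq> V" for W
        using mult_le_mono2[OF cut_m[OF that], of z] mult_le_mono2[OF cut_m[OF that], of "r - z"]
          \<open>r \<le> z * m\<close> \<open>r \<le> (r - z) * m\<close> by linarith+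
      then show ?thesis using parity_factor_if_cuts[OF r0] h(4) assms(11) by auto
    qed
    \<comment> \<open>By \<open>ra\<close> and \<open>rb\<close>, each of \<open>a\<close> and
      \<open>b\<close> satisfies one of the two bounds of \<open>near\<close>. If one of them
      satisfies both, it serves as constant degree; otherwise \<open>2 \<le> m\<close> forces
      \<open>a\<close> below \<open>r / 2\<close> and \<open>b\<close> above it.\<close>
    show ?thesis
    proof (cases "r \<le> a * m \<or> r \<le> (r - b) * m")
      case True
      then show ?thesis
      proof
        assume "r \<le> a * m"
        then obtain F where "parity_factor a a V E F" using near[of a a a] ra assms by auto
        then show ?thesis using parity_factor_mono assms by blast
      next
        assume "r \<le> (r - b) * m"
        then obtain F where "parity_factor b b V E F" using near[of b b b] rb assms by auto
        then show ?thesis using parity_factor_mono[of b b V E F a b] assms(2) by auto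
      qed
    next
      case False
      \<comment> \<open>Half of \<open>r\<close> satisfies both bounds because
        \<open>2 \<le> m\<close>. If odd, it is the constant degree; if even, it is the mean of the
        odd degrees \<open>z - 1\<close> and \<open>z + 1\<close>.\<close>
      define z where "z = r div 2"
      have z: "r = 2 * z" using h(1) by (simp add: z_def)
      have az: "a < z" "z < b"
        using mult_le_mono2[OF m2, of a] mult_le_mono2[OF m2, of "r - b"] False z assms(3)
        by linarith+
      have zm: "r \<le> z * m" "r \<le> (r - z) * m" using mult_le_mono2[OF m2, of z] z by auto
      show ?thesis
      proof (cases "odd z")
        case True
        obtain F where "parity_factor z z V E F" using near[of z z z] zm az z by auto
        then show ?thesis
          using parity_factor_mono[of z z V E F a b] az True h by (auto simp: cong_def mod_2_eq_odd)
      next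
        case False
        have "1 \<le> z - 1" "z + 1 = z - 1 + 2" "z - 1 + (z + 1) = 2 * z" "z \<le> r"
          using az z assms(1) by auto
        then obtain F where "parity_factor (z - 1) (z + 1) V E F"
          using near[of "z - 1" "z + 1" z] zm by blast
        moreover have "a \<le> z - 1" "z + 1 \<le> b" "[z + 1 = b] (mod 2)"
          using az False h by (auto simp: cong_def mod_2_eq_odd)
        ultimately show ?thesis using parity_factor_mono by blast
      qed
    qed
  qed
qed

end
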